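(* Let a partial action of a monoid $M$ with unit $e$ on a set $X$ be given, and let $Y$ be its globalization, with $i:X\to Y$, $i(x)=[e,x]$. Then $i$ is injective, and the action of $M$ on $Y$ induces the original partial action on $X$; that is, for all $u\in M$ and $x,y\in X$, $u\cdot i(x)=i(y)$ in $Y$ if and only if $u\cdot x$ is defined in $X$ and equal to $y$.
   Context: Partial action: a partial map $M\times X\to X$, $(u,x)\mapsto u\cdot x$, with $e\cdot x=x$ for all $x$ and such that, whenever $v\cdot x$ is defined, $(uv)\cdot x$ is defined iff $u\cdot(v\cdot x)$ is defined, in which case they are equal. Globalization: $Y=(M\times X)/{\simeq}$, where $\simeq$ is the equivalence relation generated by $(uv,x)\sim(u,v\cdot x)$ whenever $v\cdot x$ is defined; $[u,x]$ is the class of $(u,x)$. $M$ acts (totally) on $Y$ by $u\cdot[v,x]=[uv,x]$. *)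

theory Defs
  imports "HOL-Algebra.Group"
begin

text \<open>A partial map \<open>M \<times> X \<rightharpoonup> X\<close> is a function into \<open>'x option\<close>, \<open>None\<close> meaning ``undefined'';
  only its values on \<open>carrier M \<times> X\<close> matter. The equation in \<open>act_mult\<close> is between options:
  one side is defined iff the other is, and then they are equal.\<close>

locale partial_action = monoid M
  for M :: "('m, 'b) monoid_scheme" (structure) +
  fixes X :: "'x set" and act :: "'m \<Rightarrow> 'x \<Rightarrow> 'x option"
  assumes act_closed:
      "\<lbrakk>u \<in> carrier M; x \<in> X; act u x = Some y\<rbrakk> \<Longrightarrow> y \<in> X"
    and act_one: "x \<in> X \<Longrightarrow> act \<one> x = Some x"
    and act_mult:
      "\<lbrakk>u \<in> carrier M; v \<in> carrier M; x \<in> X; act v x = Some y\<rbrakk>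
        \<Longrightarrow> act (u \<otimes> v) x = act u y"

inductive glob_step ::
    "('m, 'b) monoid_scheme \<Rightarrow> 'x set \<Rightarrow> ('m \<Rightarrow> 'x \<Rightarrow> 'x option) \<Rightarrow> 'm \<times> 'x \<Rightarrow> 'm \<times> 'x \<Rightarrow> bool"
  for M :: "('m, 'b) monoid_scheme" and X act where
  "\<lbrakk>u \<in> carrier M; v \<in> carrier M; x \<in> X; act v x = Some y\<rbrakk>
    \<Longrightarrow> glob_step M X act (u \<otimes>\<^bsub>M\<^esub> v, x) (u, y)"

definition glob_rel ::
    "('m, 'b) monoid_scheme \<Rightarrow> 'x set \<Rightarrow> ('m \<Rightarrow> 'x \<Rightarrow> 'x option) \<Rightarrow> (('m \<times> 'x) \<times> ('m \<times> 'x)) set" where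
  "glob_rel M X act =
    {(p, q). p \<in> carrier M \<times> X \<and> q \<in> carrier M \<times> X \<and> equivclp (glob_step M X act) p q}"

definition globalization ::
    "('m, 'b) monoid_scheme \<Rightarrow> 'x set \<Rightarrow> ('m \<Rightarrow> 'x \<Rightarrow> 'x option) \<Rightarrow> ('m \<times> 'x) set set" where
  "globalization M X act = (carrier M \<times> X) // glob_rel M X act"

definition glob_class ::
    "('m, 'b) monoid_scheme \<Rightarrow> 'x set \<Rightarrow> ('m \<Rightarrow> 'x \<Rightarrow> 'x option) \<Rightarrow> 'm \<Rightarrow> 'x \<Rightarrow> ('m \<times> 'x) set" where
  "glob_class M X act u x = glob_rel M X act `` {(u, x)}"

text \<open>The action \<open>u \<cdot> [v, x] = [u v, x]\<close>: the union is over all representatives \<open>(v, x)\<close> of the class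
  \<open>c\<close>, and all the classes united are equal (lemma \<open>glob_act_class\<close> below).\<close>

definition glob_act ::
    "('m, 'b) monoid_scheme \<Rightarrow> 'x set \<Rightarrow> ('m \<Rightarrow> 'x \<Rightarrow> 'x option) \<Rightarrow> 'm \<Rightarrow> ('m \<times> 'x) set \<Rightarrow> ('m \<times> 'x) set" where
  "glob_act M X act u c = (\<Union>(v, x)\<in>c. glob_class M X act (u \<otimes>\<^bsub>M\<^esub> v) x)"

definition glob_incl ::
    "('m, 'b) monoid_scheme \<Rightarrow> 'x set \<Rightarrow> ('m \<Rightarrow> 'x \<Rightarrow> 'x option) \<Rightarrow> 'x \<Rightarrow> ('m \<times> 'x) set" where
  "glob_incl M X act x = glob_class M X act \<one>\<^bsub>M\<^esub> x"

lemma equiv_glob_rel: "equiv (carrier M \<times> X) (glob_rel M X act)"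
  unfolding glob_rel_def
  by (intro equivI refl_onI symI transI) (auto intro: equivclp_sym equivclp_trans)

context partial_action
begin

lemma glob_step_carrier:
  "glob_step M X act p q \<Longrightarrow> p \<in> carrier M \<times> X \<and> q \<in> carrier M \<times> X"
  by (auto elim!: glob_step.cases intro: act_closed)

lemma glob_step_in_rel: "glob_step M X act p q \<Longrightarrow> (p, q) \<in> glob_rel M X act"
  using glob_step_carrier[of p q] by (auto simp: glob_rel_def)

lemma glob_rel_least:
  assumes "equiv (carrier M \<times> X) E" and "\<And>p q. glob_step M X act p q \<Longrightarrow> (p, q) \<in> E"
  shows "glob_rel M X act \<subseteq> E"
proof -
  have "(p, q) \<in> E" if "equivclp (glob_step M X act) p q" "p \<in> carrier M \<times> X" for p q
    using that
  proof (induction rule: equivclp_induct)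
    case base
    then show ?case using assms(1) by (meson equivE refl_onD)
  next
    case (step y z)
    then show ?case using assms by (meson equivE symD transD)
  qed
  then show ?thesis by (auto simp: glob_rel_def)
qed

lemma glob_rel_mult_left:
  assumes "u \<in> carrier M" "((v, x), (w, y)) \<in> glob_rel M X act"
  shows "((u \<otimes> v, x), (u \<otimes> w, y)) \<in> glob_rel M X act"
proof -
  let ?f = "\<lambda>(v, x). (u \<otimes> v, x)"
  have s: "glob_step M X act (?f p) (?f q)" if "glob_step M X act p q" for p q
    using that
  proof cases
    case (1 w z x y)
    then show ?thesis
      using glob_step.intros[of "u \<otimes> w" M z x X act y] assms(1) by (simp add: m_assoc)
  qed
  have "equivclp (glob_step M X act) (?f p) (?f q)" if "equivclp (glob_step M X act) p q" for p q
    using that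
  proof (induction rule: equivclp_induct)
    case base
    then show ?case by simp
  next
    case (step y z)
    then have "equivclp (glob_step M X act) (?f y) (?f z)"
      using s[of y z] s[of z y] by (blast intro: r_into_equivclp equivclp_sym)
    with step.IH show ?case by (rule equivclp_trans)
  qed
  from this[of "(v, x)" "(w, y)"] assms show ?thesis
    by (simp add: glob_rel_def)
qed

lemma glob_act_class:
  assumes "u \<in> carrier M" "v \<in> carrier M" "x \<in> X"
  shows "glob_act M X act u (glob_class M X act v x) = glob_class M X act (u \<otimes> v) x"
proof -
  have "glob_class M X act (u \<otimes> w) y = glob_class M X act (u \<otimes> v) x"
    if "(w, y) \<in> glob_class M X act v x" for w y
    using that glob_rel_mult_left[OF assms(1)] equiv_class_eq[OF equiv_glob_rel]
    unfolding glob_class_def by blast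
  moreover have "(v, x) \<in> glob_class M X act v x"
    using assms by (auto simp: glob_class_def glob_rel_def)
  ultimately show ?thesis unfolding glob_act_def by blast
qed

lemma globalization_cases:
  assumes "c \<in> globalization M X act"
  obtains v x where "v \<in> carrier M" "x \<in> X" "c = glob_class M X act v x"
  using assms by (auto simp: globalization_def glob_class_def elim!: quotientE)

lemma glob_class_in: "\<lbrakk>v \<in> carrier M; x \<in> X\<rbrakk> \<Longrightarrow> glob_class M X act v x \<in> globalization M X act"
  by (auto simp: globalization_def glob_class_def intro: quotientI)

lemma glob_incl_in: "x \<in> X \<Longrightarrow> glob_incl M X act x \<in> globalization M X act"
  by (simp add: glob_incl_def glob_class_in)

lemma glob_act_in:
  "\<lbrakk>u \<in> carrier M; c \<in> globalization M X act\<rbrakk> \<Longrightarrow> glob_act M X act u c \<in> globalization M X act"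
  by (auto elim!: globalization_cases simp: glob_act_class glob_class_in)

lemma glob_act_one: "c \<in> globalization M X act \<Longrightarrow> glob_act M X act \<one> c = c"
  by (auto elim!: globalization_cases simp: glob_act_class)

lemma glob_act_mult:
  "\<lbrakk>u \<in> carrier M; v \<in> carrier M; c \<in> globalization M X act\<rbrakk>
    \<Longrightarrow> glob_act M X act (u \<otimes> v) c = glob_act M X act u (glob_act M X act v c)"
  by (auto elim!: globalization_cases simp: glob_act_class m_assoc)

end

end

theory Submission
  imports Defs
begin

text \<open>The value \<open>u \<cdot> x\<close>, undefinedness included, is constant on the classes \<open>[u, x]\<close>: for a
  generating pair this is exactly the partial action axiom. Hence \<open>[u, x] = [e, y]\<close> forces
  \<open>u \<cdot> x = e \<cdot> y = y\<close>.\<close>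

context partial_action
begin

lemma glob_rel_act_eq:
  assumes "((u, x), (v, y)) \<in> glob_rel M X act"
  shows "act u x = act v y"
proof -
  \<comment> \<open>\<open>?E\<close> is the kernel of \<open>(u, x) \<mapsto> act u x\<close> with
    values in options, hence an equivalence; by minimality of \<open>glob_rel\<close> only
    generating pairs need checking.\<close>
  let ?E = "{(p, q). p \<in> carrier M \<times> X \<and> q \<in> carrier M \<times> X
    \<and> case_prod act p = case_prod act q}"
  have "equiv (carrier M \<times> X) ?E"
    by (intro equivI refl_onI symI transI) auto
  moreover have "(p, q) \<in> ?E" if "glob_step M X act p q" for p q
    using that glob_step_carrier[OF that] by cases (simp add: act_mult)
  ultimately have "glob_rel M X act \<subseteq> ?E"
    by (rule glob_rel_least)
  with assms show ?thesis by auto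
qed

text \<open>Common source of both claims: \<open>u = \<one>\<close> yields injectivity, and for
  general \<open>u\<close> the class on the left is \<open>u\<close> acting on the image of
  \<open>x\<close>.\<close>

lemma glob_class_eq_incl_iff:
  assumes "u \<in> carrier M" "x \<in> X" "y \<in> X"
  shows "glob_class M X act u x = glob_incl M X act y \<longleftrightarrow> act u x = Some y"
proof -
  have "glob_class M X act u x = glob_incl M X act y
      \<longleftrightarrow> ((u, x), (\<one>, y)) \<in> glob_rel M X act"
    using assms by (simp add: glob_class_def glob_incl_def eq_equiv_class_iff[OF equiv_glob_rel])
  also have "\<dots> \<longleftrightarrow> act u x = Some y"
  proof
    assume "((u, x), (\<one>, y)) \<in> glob_rel M X act"
    then show "act u x = Some y"
      using glob_rel_act_eq assms(3) act_one by metis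
  next
    assume "act u x = Some y"
    \<comment> \<open>Writing \<open>u\<close> as \<open>\<one> \<otimes> u\<close> lets a single
      generating step move all of \<open>u\<close> across onto \<open>x\<close>.\<close>
    then have "glob_step M X act (\<one> \<otimes> u, x) (\<one>, y)"
      using assms by (intro glob_step.intros) auto
    then show "((u, x), (\<one>, y)) \<in> glob_rel M X act"
      using glob_step_in_rel assms(1) by simp
  qed
  finally show ?thesis .
qed

lemma inj_on_glob_incl: "inj_on (glob_incl M X act) X"
proof (rule inj_onI)
  fix x y assume "x \<in> X" "y \<in> X" "glob_incl M X act x = glob_incl M X act y"
  then show "x = y"
    \<comment> \<open>Equal images force \<open>act \<one> x = Some y\<close>, while the unit axiom
      gives \<open>Some x\<close>.\<close>
    using glob_class_eq_incl_iff[of \<one> x y] act_one by (simp add: glob_incl_def)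
qed

lemma glob_act_incl:
  "\<lbrakk>u \<in> carrier M; x \<in> X\<rbrakk>
    \<Longrightarrow> glob_act M X act u (glob_incl M X act x) = glob_class M X act u x"
  by (simp add: glob_incl_def glob_act_class)

end

theorem proposition2p6:
  fixes M :: "('m, 'b) monoid_scheme"
    and X :: "'x set"
    and act :: "'m \<Rightarrow> 'x \<Rightarrow> 'x option"
  assumes "partial_action M X act"
  shows "inj_on (glob_incl M X act) X \<and>
    (\<forall>u \<in> carrier M. \<forall>x \<in> X. \<forall>y \<in> X.
       glob_act M X act u (glob_incl M X act x) = glob_incl M X act y \<longleftrightarrow> act u x = Some y)"
proof -
  interpret partial_action M X act by fact
  show ?thesis
    using inj_on_glob_incl by (simp add: glob_act_incl glob_class_eq_incl_iff)
qed

end
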